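(* Let $\mathbb{Y}$ be a real $F$-space whose metric $d_{\mathbb{Y}}$ is homogeneous. Let $1<N\in\mathbb{N}$, let $\mathbb{X}$ be a nonempty connected set, and let $\{\mathbb{X}_i \mid i=1,\dots,N\}$ be a family of nonempty connected subsets of $\mathbb{X}$. Suppose $\{u_i:\mathbb{X}_i\to\mathbb{X}\mid i=1,\dots,N\}$ is a family of mappings, each a bijection onto its image $u_i(\mathbb{X}_i)$, such that $\mathbb{X}=\bigcup_{i=1}^N u_i(\mathbb{X}_i)$ and $u_i(\mathbb{X}_i)\cap u_j(\mathbb{X}_j)=\emptyset$ for all $i\ne j$. Let $\boldsymbol{\lambda}=(\lambda_1,\dots,\lambda_N)\in\prod_{i=1}^N B(\mathbb{X}_i,\mathbb{Y})$ and $\boldsymbol{S}=(S_1,\dots,S_N)\in\prod_{i=1}^N B(\mathbb{X}_i,\mathbb{R})$. Define a mapping $\Phi:\left(\prod_{i=1}^N B(\mathbb{X}_i,\mathbb{Y})\right)\times\left(\prod_{i=1}^N B(\mathbb{X}_i,\mathbb{R})\right)\times B(\mathbb{X},\mathbb{Y})\to B(\mathbb{X},\mathbb{Y})$ by $$\Phi(\boldsymbol{\lambda})(\boldsymbol{S})f=\sum_{i=1}^N(\lambda_i\circ u_i^{-1})\,\chi_{u_i(\mathbb{X}_i)}+\sum_{i=1}^N(S_i\circ u_i^{-1})\cdot(f_i\circ u_i^{-1})\,\chi_{u_i(\mathbb{X}_i)},\qquad f_i:=f|_{\mathbb{X}_i}.$$ If $\max\{\|S_i\|_{\infty,\mathbb{X}_i}\mid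 i=1,\dots,N\}<1$, then the operator $\Phi(\boldsymbol{\lambda})(\boldsymbol{S})$ is contractive on the complete metric space $B(\mathbb{X},\mathbb{Y})$, and its unique fixed point $f^*$ satisfies the self-referential equation $$f^*=\sum_{i=1}^N(\lambda_i\circ u_i^{-1})\,\chi_{u_i(\mathbb{X}_i)}+\sum_{i=1}^N(S_i\circ u_i^{-1})\cdot(f^*_i\circ u_i^{-1})\,\chi_{u_i(\mathbb{X}_i)},$$ or, equivalently, $$f^*\circ u_i=\lambda_i+S_i\cdot f^*_i\quad\text{on }\mathbb{X}_i\text{ for all }i=1,\dots,N,$$ where $f^*_i:=f^*|_{\mathbb{X}_i}$.
   Context: An $F$-space is a topological vector space whose topology is induced by a complete translation-invariant metric. The metric $d_{\mathbb{Y}}$ (complete, translation-invariant) is homogeneous if $d_{\mathbb{Y}}(\alpha y_1,\alpha y_2)=|\alpha|\,d_{\mathbb{Y}}(y_1,y_2)$ for all $\alpha\in\mathbb{R}$, $y_1,y_2\in\mathbb{Y}$. For a set $E$, a function $f:E\to\mathbb{Y}$ is bounded if there is $M>0$ with $d_{\mathbb{Y}}(f(x_1),f(x_2))<M$ for all $x_1,x_2\in E$; $B(E,\mathbb{Y})$ is the set of bounded functions $E\to\mathbb{Y}$, with metric $d(f,g):=\sup_{x\in E}d_{\mathbb{Y}}(f(x),g(x))$, which is complete. $B(E,\mathbb{R})$ denotes the bounded real-valued functions on $E$, and $\|\cdot\|_{\infty,\mathbb{X}_i}$ is the supremum norm over $\mathbb{X}_i$. $\chi_M$ is the indicator function of $M$;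 a term such as $(\lambda_i\circ u_i^{-1})\chi_{u_i(\mathbb{X}_i)}$ is understood to be $0$ outside $u_i(\mathbb{X}_i)$. The fixed point $f^*$ is called a local fractal function. *)

theory Defs
  imports "HOL-Analysis.Analysis"
begin

class real_f_space = real_vector + topological_ab_group_add + complete_space +
  assumes tendsto_scaleR_nhds:
      "LIM p (nhds a \<times>\<^sub>F nhds x). fst p *\<^sub>R snd p :> nhds (a *\<^sub>R x)"
    and dist_translation: "dist (x + z) (y + z) = dist x y"

text \<open>The space of bounded functions on \<open>E\<close> with the supremum metric. Functions on \<open>E\<close> are
  represented by elements of \<^term>\<open>extensional E\<close>, so that equality is equality on \<open>E\<close>.
  The two lemmas below recover the textbook descriptions of the carrier and the metric.\<close>

definition bfun_metric :: "'a set \<Rightarrow> ('a \<Rightarrow> 'y::metric_space) metric"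
  where "bfun_metric E = funspace E euclidean_metric"

abbreviation bfun :: "'a set \<Rightarrow> ('a \<Rightarrow> 'y::metric_space) set"
  where "bfun E \<equiv> mspace (bfun_metric E)"

lemma Metric_space_dist: "Metric_space (UNIV :: 'y::metric_space set) dist"
  using Metric_space_mspace_mdist[of "euclidean_metric :: 'y metric"] by simp

lemma bfun_eq:
  "bfun E = {f \<in> extensional E. \<exists>M>0. \<forall>x1\<in>E. \<forall>x2\<in>E. dist (f x1) (f x2) < M}"
proof -
  have "(\<exists>B. \<forall>x\<in>E. \<forall>y\<in>E. dist (f x) (f y) \<le> B) \<longleftrightarrow>
        (\<exists>M>0. \<forall>x\<in>E. \<forall>y\<in>E. dist (f x) (f y) < M)" for f :: "'a \<Rightarrow> 'b"
  proof
    assume "\<exists>B. \<forall>x\<in>E. \<forall>y\<in>E. dist (f x) (f y) \<le> B"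
    then obtain B where "\<forall>x\<in>E. \<forall>y\<in>E. dist (f x) (f y) \<le> B" by blast
    then have "\<forall>x\<in>E. \<forall>y\<in>E. dist (f x) (f y) < \<bar>B\<bar> + 1" by fastforce
    then show "\<exists>M>0. \<forall>x\<in>E. \<forall>y\<in>E. dist (f x) (f y) < M"
      by (intro exI[of _ "\<bar>B\<bar> + 1"]) auto
  qed (use less_imp_le in blast)
  then show ?thesis
    by (auto simp: bfun_metric_def Metric_space.fspace_def[OF Metric_space_dist]
        bounded_two_points)
qed

lemma mdist_bfun_metric:
  assumes "f \<in> bfun E" "g \<in> bfun E" "E \<noteq> {}"
  shows "mdist (bfun_metric E) f g = (SUP x\<in>E. dist (f x) (g x))"
  using assms by (simp add: bfun_metric_def Metric_space.fdist_def[OF Metric_space_dist])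

definition sup_norm_on :: "'a set \<Rightarrow> ('a \<Rightarrow> real) \<Rightarrow> real"
  where "sup_norm_on E s = (SUP x\<in>E. \<bar>s x\<bar>)"

text \<open>Outside \<open>u i ` Xi i\<close> the value of \<^const>\<open>inv_into\<close> is unspecified, but there the
  indicator vanishes, so the corresponding summand is \<open>0\<close>, as intended.\<close>

definition Phi :: "nat \<Rightarrow> 'a set \<Rightarrow> (nat \<Rightarrow> 'a set) \<Rightarrow> (nat \<Rightarrow> 'a \<Rightarrow> 'a) \<Rightarrow>
    (nat \<Rightarrow> 'a \<Rightarrow> 'y::real_vector) \<Rightarrow> (nat \<Rightarrow> 'a \<Rightarrow> real) \<Rightarrow> ('a \<Rightarrow> 'y) \<Rightarrow> 'a \<Rightarrow> 'y"
  where "Phi N X Xi u lam S f = (\<lambda>x\<in>X.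
      (\<Sum>i=1..N. indicator (u i ` Xi i) x *\<^sub>R (lam i \<circ> inv_into (Xi i) (u i)) x)
    + (\<Sum>i=1..N. indicator (u i ` Xi i) x *\<^sub>R
         ((S i \<circ> inv_into (Xi i) (u i)) x *\<^sub>R (restrict f (Xi i) \<circ> inv_into (Xi i) (u i)) x)))"

definition contractive :: "'a metric \<Rightarrow> ('a \<Rightarrow> 'a) \<Rightarrow> bool"
  where "contractive m T \<longleftrightarrow> T \<in> mspace m \<rightarrow> mspace m \<and>
    (\<exists>k. 0 \<le> k \<and> k < 1 \<and> (\<forall>f\<in>mspace m. \<forall>g\<in>mspace m. mdist m (T f) (T g) \<le> k * mdist m f g))"

end

theory Submission
  imports Defs
begin

text \<open>
  The images \<open>u i ` Xi i\<close> partition \<open>X\<close>. A point of \<open>X\<close> is therefore \<open>u i z\<close> for exactly one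
  \<open>i\<close> and one \<open>z \<in> Xi i\<close>, both sums in \<^const>\<open>Phi\<close> collapse to their \<open>i\<close>-th summand there, and
  the operator is just \<open>f (u i z) \<mapsto> lam i z + S i z *\<^sub>R f z\<close> (\<open>Phi_at_image\<close>). Everything follows
  from this pointwise description.

  \<^item> \<open>Phi\<close> preserves boundedness: a homogeneous translation-invariant metric makes
    \<open>y \<mapsto> dist y 0\<close> behave as a norm, so that \<open>lam i z + S i z *\<^sub>R f z\<close> is bounded because
    \<open>lam i\<close>, \<open>S i\<close> and \<open>f\<close> are, and there are only finitely many \<open>i\<close>.
  \<^item> \<open>Phi\<close> is a contraction: for two functions \<open>f\<close> and \<open>g\<close> the summand \<open>lam i z\<close> cancels, and
    homogeneity turns the distance into \<open>\<bar>S i z\<bar> * dist (f z) (g z)\<close>. The contraction factor is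
    thus the largest of the supremum norms of the \<open>S i\<close>.
  \<^item> Bounded functions into a complete space form a complete space, so the Banach fixed point
    theorem applies.
  \<^item> The two forms of the self-referential equation agree for every function, because both say
    that \<open>f\<close> equals \<open>Phi f\<close> at each point \<open>u i z\<close>.
\<close>

section \<open>Spaces of bounded functions\<close>

lemma bfun_iff_bounded_image:
  fixes f :: "'a \<Rightarrow> 'y::metric_space"
  shows "f \<in> bfun E \<longleftrightarrow> f \<in> extensional E \<and> bounded (f ` E)"
  by (auto simp: bfun_metric_def Metric_space.fspace_def[OF Metric_space_dist])

lemma bounded_iff_dist_zero:
  fixes A :: "'y::{metric_space, zero} set"
  shows "bounded A \<longleftrightarrow> (\<exists>B\<ge>0. \<forall>y\<in>A. dist y 0 \<le> B)"
proof
  assume "bounded A"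
  then obtain B where B: "\<forall>y\<in>A. dist 0 y \<le> B"
    by (meson bounded_any_center)
  then show "\<exists>B\<ge>0. \<forall>y\<in>A. dist y 0 \<le> B"
    by (intro exI[of _ "max 0 B"]) (auto simp: dist_commute le_max_iff_disj)
next
  assume "\<exists>B\<ge>0. \<forall>y\<in>A. dist y 0 \<le> B"
  then show "bounded A"
    by (metis bounded_def dist_commute)
qed

lemma dist_le_mdist_bfun_metric:
  fixes f g :: "'a \<Rightarrow> 'y::metric_space"
  assumes "f \<in> bfun E" "g \<in> bfun E" "x \<in> E"
  shows "dist (f x) (g x) \<le> mdist (bfun_metric E) f g"
proof -
  have "bdd_above ((\<lambda>x. dist (f x) (g x)) ` E)"
    using assms by (intro Metric_space.bdd_above_dist[OF Metric_space_dist])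
      (auto simp: bfun_metric_def)
  moreover have "E \<noteq> {}"
    using assms(3) by blast
  ultimately show ?thesis
    using assms cSUP_upper[OF assms(3), of "\<lambda>x. dist (f x) (g x)"]
    by (simp add: mdist_bfun_metric)
qed

lemma mcomplete_of_bfun_metric:
  "mcomplete_of (bfun_metric E :: ('a \<Rightarrow> 'y::complete_space) metric)"
  using Metric_space.mcomplete_funspace[OF Metric_space_dist, of E]
    complete_UNIV[where 'a='y]
  by (simp add: mcomplete_of_def bfun_metric_def mcomplete_iff_complete)

lemma abs_le_sup_norm_on:
  assumes "s \<in> bfun E" "x \<in> E"
  shows "\<bar>s x\<bar> \<le> sup_norm_on E s"
proof -
  obtain B where "\<forall>x\<in>E. \<bar>s x\<bar> \<le> B"
    using assms by (auto simp: bfun_iff_bounded_image bounded_iff_dist_zero)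
  then have "bdd_above ((\<lambda>x. \<bar>s x\<bar>) ` E)"
    by (auto intro: bdd_aboveI2)
  then show ?thesis
    unfolding sup_norm_on_def using assms(2) by (rule cSUP_upper2) simp
qed

lemma dist_add_zero_le:
  fixes a b :: "'y::real_f_space"
  shows "dist (a + b) 0 \<le> dist a 0 + dist b 0"
  using dist_triangle[of "a + b" 0 b] dist_translation[of a b 0] by simp

section \<open>Fixed points of contractions\<close>

lemma contractive_unique_fixpoint:
  assumes "mcomplete_of m" "contractive m T" "mspace m \<noteq> {}"
  shows "\<exists>p\<in>mspace m. \<forall>f\<in>mspace m. T f = f \<longleftrightarrow> f = p"
proof -
  interpret Metric_space "mspace m" "mdist m"
    by simp
  obtain k where T: "T \<in> mspace m \<rightarrow> mspace m" and k: "k < 1"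
      "\<And>f g. f \<in> mspace m \<Longrightarrow> g \<in> mspace m \<Longrightarrow> mdist m (T f) (T g) \<le> k * mdist m f g"
    using assms(2) by (auto simp: contractive_def)
  obtain p where p: "p \<in> mspace m" "T p = p"
    using Banach_fixedpoint_thm[OF _ assms(3) T k] assms(1) by (auto simp: mcomplete_of_def)
  moreover have "f = p" if "f \<in> mspace m" "T f = f" for f
    using contraction_imp_unique_fixpoint[OF that(2) p(2) T k that(1) p(1)] .
  ultimately show ?thesis
    by blast
qed

section \<open>The operator on the pieces of the partition\<close>

lemma sum_indicator_disjoint:
  fixes h :: "'i \<Rightarrow> 'y::real_vector"
  assumes "finite I" "disjoint_family_on A I" "j \<in> I" "x \<in> A j"
  shows "(\<Sum>i\<in>I. indicator (A i) x *\<^sub>R h i) = h j"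
proof -
  have "(\<Sum>i\<in>I. indicator (A i) x *\<^sub>R h i) = (\<Sum>i\<in>I. if i = j then h j else 0)"
    using assms(2-4) by (intro sum.cong) (auto simp: disjoint_family_on_def indicator_def)
  then show ?thesis
    using assms(1,3) by simp
qed

text \<open>Injectivity of \<open>u i\<close> is what lets \<^const>\<open>inv_into\<close> recover \<open>z\<close> from \<open>u i z\<close>, and disjointness
  of the images removes every other summand.\<close>

lemma Phi_at_image:
  assumes "disjoint_family_on (\<lambda>i. u i ` Xi i) {1..N}"
    and "i \<in> {1..N}" "inj_on (u i) (Xi i)" "z \<in> Xi i" "u i z \<in> X"
  shows "Phi N X Xi u lam S f (u i z) = lam i z + S i z *\<^sub>R f z"
proof -
  have "u i z \<in> u i ` Xi i"
    using assms(4) by blast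
  note collapse = sum_indicator_disjoint[OF finite_atLeastAtMost assms(1,2) this]
  show ?thesis
    using assms(3-5) by (simp only: Phi_def restrict_apply' collapse) simp
qed

text \<open>Homogeneity enters through the bound \<open>\<bar>S i z\<bar> * dist (f z) 0\<close> for the second summand. The
  number of pieces is finite, so the bounds on the pieces combine to a bound on \<open>X\<close>.\<close>

lemma Phi_in_bfun:
  fixes lam :: "nat \<Rightarrow> 'a \<Rightarrow> 'y::real_f_space"
  assumes homogeneous:
      "\<And>(\<alpha>::real) (y1::'y) y2. dist (\<alpha> *\<^sub>R y1) (\<alpha> *\<^sub>R y2) = \<bar>\<alpha>\<bar> * dist y1 y2"
    and disjoint: "disjoint_family_on (\<lambda>i. u i ` Xi i) {1..N}"
    and cover: "X = (\<Union>i\<in>{1..N}. u i ` Xi i)"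
    and sub: "\<And>i. i \<in> {1..N} \<Longrightarrow> Xi i \<subseteq> X"
    and inj: "\<And>i. i \<in> {1..N} \<Longrightarrow> inj_on (u i) (Xi i)"
    and lam: "\<And>i. i \<in> {1..N} \<Longrightarrow> lam i \<in> bfun (Xi i)"
    and S: "\<And>i. i \<in> {1..N} \<Longrightarrow> S i \<in> bfun (Xi i)"
    and f: "f \<in> bfun X"
  shows "Phi N X Xi u lam S f \<in> bfun X"
proof -
  let ?T = "Phi N X Xi u lam S f"
  obtain F where F: "F \<ge> 0" "\<And>x. x \<in> X \<Longrightarrow> dist (f x) 0 \<le> F"
    using f by (auto simp: bfun_iff_bounded_image bounded_iff_dist_zero)
  have "bounded (?T ` (u i ` Xi i))" if i: "i \<in> {1..N}" for i
  proof -
    obtain L where L: "L \<ge> 0" "\<And>z. z \<in> Xi i \<Longrightarrow> dist (lam i z) 0 \<le> L"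
      using lam[OF i] by (auto simp: bfun_iff_bounded_image bounded_iff_dist_zero)
    obtain B where B: "B \<ge> 0" "\<And>z. z \<in> Xi i \<Longrightarrow> \<bar>S i z\<bar> \<le> B"
      using S[OF i] by (auto simp: bfun_iff_bounded_image bounded_iff_dist_zero)
    have "dist (?T (u i z)) 0 \<le> L + B * F" if z: "z \<in> Xi i" for z
    proof -
      have "u i z \<in> X" "z \<in> X"
        using cover sub[OF i] i z by blast+
      then have "dist (?T (u i z)) 0 \<le> dist (lam i z) 0 + dist (S i z *\<^sub>R f z) 0"
        using Phi_at_image[OF disjoint i inj[OF i] z] by (metis dist_add_zero_le)
      also have "dist (S i z *\<^sub>R f z) 0 = \<bar>S i z\<bar> * dist (f z) 0"
        using homogeneous[of "S i z" "f z" 0] by simp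
      also have "\<dots> \<le> B * F"
        using B F z \<open>z \<in> X\<close> by (intro mult_mono) auto
      finally show ?thesis
        using L(2)[OF z] by linarith
    qed
    moreover have "0 \<le> L + B * F"
      using L(1) B(1) F(1) by simp
    ultimately show ?thesis
      unfolding bounded_iff_dist_zero by blast
  qed
  then have "bounded (\<Union>i\<in>{1..N}. ?T ` (u i ` Xi i))"
    by (intro bounded_UN) auto
  then have "bounded (?T ` X)"
    by (subst cover) (simp only: image_UN)
  then show ?thesis
    by (simp add: bfun_iff_bounded_image Phi_def)
qed

text \<open>After translating \<open>lam i z\<close> away, homogeneity leaves \<open>\<bar>S i z\<bar> * dist (f z) (g z)\<close>, and
  \<open>Xi i \<subseteq> X\<close> lets the supremum metric on \<open>X\<close> control \<open>dist (f z) (g z)\<close>.\<close>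

lemma mdist_Phi_le:
  fixes lam :: "nat \<Rightarrow> 'a \<Rightarrow> 'y::real_f_space"
  assumes homogeneous:
      "\<And>(\<alpha>::real) (y1::'y) y2. dist (\<alpha> *\<^sub>R y1) (\<alpha> *\<^sub>R y2) = \<bar>\<alpha>\<bar> * dist y1 y2"
    and nonempty: "X \<noteq> {}"
    and disjoint: "disjoint_family_on (\<lambda>i. u i ` Xi i) {1..N}"
    and cover: "X = (\<Union>i\<in>{1..N}. u i ` Xi i)"
    and sub: "\<And>i. i \<in> {1..N} \<Longrightarrow> Xi i \<subseteq> X"
    and inj: "\<And>i. i \<in> {1..N} \<Longrightarrow> inj_on (u i) (Xi i)"
    and S: "\<And>i z. i \<in> {1..N} \<Longrightarrow> z \<in> Xi i \<Longrightarrow> \<bar>S i z\<bar> \<le> k"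
    and f: "f \<in> bfun X" "Phi N X Xi u lam S f \<in> bfun X"
    and g: "g \<in> bfun X" "Phi N X Xi u lam S g \<in> bfun X"
  shows "mdist (bfun_metric X) (Phi N X Xi u lam S f) (Phi N X Xi u lam S g)
    \<le> k * mdist (bfun_metric X) f g"
proof -
  let ?T = "Phi N X Xi u lam S"
  have "dist (?T f x) (?T g x) \<le> k * mdist (bfun_metric X) f g" if "x \<in> X" for x
  proof -
    have "x \<in> (\<Union>i\<in>{1..N}. u i ` Xi i)"
      using that by (simp only: cover[symmetric])
    then obtain i z where i: "i \<in> {1..N}" and z: "z \<in> Xi i" and x: "x = u i z"
      by blast
    have "z \<in> X"
      using sub[OF i] z by blast
    have T: "?T h x = S i z *\<^sub>R h z + lam i z" for h
      using Phi_at_image[OF disjoint i inj[OF i] z] \<open>x \<in> X\<close> x by (simp add: add.commute)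
    have "dist (?T f x) (?T g x) = \<bar>S i z\<bar> * dist (f z) (g z)"
      by (simp add: T dist_translation homogeneous)
    also have "\<dots> \<le> k * mdist (bfun_metric X) f g"
      using S[OF i z] dist_le_mdist_bfun_metric[OF f(1) g(1) \<open>z \<in> X\<close>]
      by (intro mult_mono) auto
    finally show ?thesis .
  qed
  then show ?thesis
    using nonempty by (simp add: mdist_bfun_metric f g cSUP_least)
qed

section \<open>The local fractal function\<close>

theorem theorem3p2:
  fixes N :: nat
    and X :: "'a::topological_space set"
    and Xi :: "nat \<Rightarrow> 'a set"
    and u :: "nat \<Rightarrow> 'a \<Rightarrow> 'a"
    and lam :: "nat \<Rightarrow> 'a \<Rightarrow> 'y::real_f_space"
    and S :: "nat \<Rightarrow> 'a \<Rightarrow> real"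
  assumes homogeneous:
      "\<And>(\<alpha>::real) (y1::'y) (y2::'y). dist (\<alpha> *\<^sub>R y1) (\<alpha> *\<^sub>R y2) = \<bar>\<alpha>\<bar> * dist y1 y2"
    and N: "1 < N"
    and X: "X \<noteq> {}" "connected X"
    and Xi: "\<And>i. i \<in> {1..N} \<Longrightarrow> Xi i \<noteq> {} \<and> connected (Xi i) \<and> Xi i \<subseteq> X"
    and u_inj: "\<And>i. i \<in> {1..N} \<Longrightarrow> inj_on (u i) (Xi i)"
    and u_cover: "X = (\<Union>i\<in>{1..N}. u i ` Xi i)"
    and u_disjoint: "\<And>i j. i \<in> {1..N} \<Longrightarrow> j \<in> {1..N} \<Longrightarrow> i \<noteq> j \<Longrightarrow>
        u i ` Xi i \<inter> u j ` Xi j = {}"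
    and lam: "lam \<in> (\<Pi>\<^sub>E i\<in>{1..N}. bfun (Xi i))"
    and S: "S \<in> (\<Pi>\<^sub>E i\<in>{1..N}. bfun (Xi i))"
  shows "Phi N X Xi u lam S \<in> bfun X \<rightarrow> bfun X \<and>
    (Max ((\<lambda>i. sup_norm_on (Xi i) (S i)) ` {1..N}) < 1 \<longrightarrow>
      mcomplete_of (bfun_metric X :: ('a \<Rightarrow> 'y) metric) \<and>
      contractive (bfun_metric X) (Phi N X Xi u lam S) \<and>
      (\<exists>fstar \<in> bfun X.
        (\<forall>f \<in> bfun X. Phi N X Xi u lam S f = f \<longleftrightarrow> f = fstar) \<and>
        (\<forall>x\<in>X. fstar x =
            (\<Sum>i=1..N. indicator (u i ` Xi i) x *\<^sub>R (lam i \<circ> inv_into (Xi i) (u i)) x)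
          + (\<Sum>i=1..N. indicator (u i ` Xi i) x *\<^sub>R
               ((S i \<circ> inv_into (Xi i) (u i)) x *\<^sub>R
                (restrict fstar (Xi i) \<circ> inv_into (Xi i) (u i)) x))) \<and>
        (\<forall>i\<in>{1..N}. \<forall>x\<in>Xi i.
            (fstar \<circ> u i) x = lam i x + S i x *\<^sub>R restrict fstar (Xi i) x)) \<and>
      (\<forall>f \<in> bfun X.
        (\<forall>x\<in>X. f x =
            (\<Sum>i=1..N. indicator (u i ` Xi i) x *\<^sub>R (lam i \<circ> inv_into (Xi i) (u i)) x)
          + (\<Sum>i=1..N. indicator (u i ` Xi i) x *\<^sub>R
               ((S i \<circ> inv_into (Xi i) (u i)) x *\<^sub>R
                (restrict f (Xi i) \<circ> inv_into (Xi i) (u i)) x)))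
        \<longleftrightarrow>
        (\<forall>i\<in>{1..N}. \<forall>x\<in>Xi i.
            (f \<circ> u i) x = lam i x + S i x *\<^sub>R restrict f (Xi i) x)))"
proof -
  let ?T = "Phi N X Xi u lam S" and ?k = "Max ((\<lambda>i. sup_norm_on (Xi i) (S i)) ` {1..N})"
  have disjoint: "disjoint_family_on (\<lambda>i. u i ` Xi i) {1..N}"
    using u_disjoint by (simp add: disjoint_family_on_def)
  have sub: "Xi i \<subseteq> X" if "i \<in> {1..N}" for i
    using Xi[OF that] by simp
  have lam_i: "lam i \<in> bfun (Xi i)" and S_i: "S i \<in> bfun (Xi i)" if "i \<in> {1..N}" for i
    using that lam S by (auto dest: PiE_mem)
  have into: "?T f \<in> bfun X" if "f \<in> bfun X" for f
    by (rule Phi_in_bfun[OF homogeneous disjoint u_cover sub u_inj lam_i S_i that])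
  have equiv: "(\<forall>x\<in>X. f x = ?T f x) \<longleftrightarrow>
      (\<forall>i\<in>{1..N}. \<forall>x\<in>Xi i. (f \<circ> u i) x = lam i x + S i x *\<^sub>R restrict f (Xi i) x)" for f
  proof -
    have "(\<forall>x\<in>X. f x = ?T f x) \<longleftrightarrow> (\<forall>i\<in>{1..N}. \<forall>x\<in>Xi i. f (u i x) = ?T f (u i x))"
      by (subst u_cover) blast
    also have "\<dots> \<longleftrightarrow> (\<forall>i\<in>{1..N}. \<forall>x\<in>Xi i. f (u i x) = lam i x + S i x *\<^sub>R f x)"
    proof (intro ball_cong refl)
      fix i x assume i: "i \<in> {1..N}" and x: "x \<in> Xi i"
      then have "u i x \<in> X"
        using u_cover by blast
      then show "(f (u i x) = ?T f (u i x)) \<longleftrightarrow> (f (u i x) = lam i x + S i x *\<^sub>R f x)"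
        by (simp only: Phi_at_image[OF disjoint i u_inj[OF i] x])
    qed
    finally show ?thesis
      by simp
  qed
  have contr: "contractive (bfun_metric X) ?T" if less: "?k < 1"
  proof -
    have S_le: "\<bar>S i z\<bar> \<le> ?k" if i: "i \<in> {1..N}" and z: "z \<in> Xi i" for i z
    proof -
      have "\<bar>S i z\<bar> \<le> sup_norm_on (Xi i) (S i)"
        by (rule abs_le_sup_norm_on[OF S_i[OF i] z])
      also have "\<dots> \<le> ?k"
        using i by (intro Max_ge) auto
      finally show ?thesis .
    qed
    \<comment> \<open>The factor is nonnegative because it dominates \<open>\<bar>S 1 z\<bar>\<close> at some point \<open>z\<close> of \<open>Xi 1\<close>.\<close>
    have "1 \<in> {1..N}"
      using N by simp
    moreover from this obtain z where "z \<in> Xi 1"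
      using Xi by blast
    ultimately have "0 \<le> ?k"
      using S_le[of 1 z] by linarith
    moreover have "mdist (bfun_metric X) (?T f) (?T g) \<le> ?k * mdist (bfun_metric X) f g"
      if "f \<in> bfun X" "g \<in> bfun X" for f g
      by (rule mdist_Phi_le[OF homogeneous X(1) disjoint u_cover sub u_inj S_le
            that(1) into[OF that(1)] that(2) into[OF that(2)]])
    ultimately show ?thesis
      using less into unfolding contractive_def by blast
  qed
  have "(\<lambda>x\<in>X. 0) \<in> (bfun X :: ('a \<Rightarrow> 'y) set)"
    by (auto simp: bfun_eq intro: exI[of _ 1])
  then have fixpoint: "\<exists>p\<in>bfun X. \<forall>f\<in>bfun X. ?T f = f \<longleftrightarrow> f = p" if "?k < 1"
    using contractive_unique_fixpoint[OF mcomplete_of_bfun_metric contr[OF that]] by blast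
  have rhs: "(\<Sum>i=1..N. indicator (u i ` Xi i) x *\<^sub>R (lam i \<circ> inv_into (Xi i) (u i)) x)
      + (\<Sum>i=1..N. indicator (u i ` Xi i) x *\<^sub>R
           ((S i \<circ> inv_into (Xi i) (u i)) x *\<^sub>R (restrict f (Xi i) \<circ> inv_into (Xi i) (u i)) x))
      = ?T f x" if "x \<in> X" for f x
    using that by (simp add: Phi_def)
  show ?thesis
  proof (intro conjI impI)
    show "?T \<in> bfun X \<rightarrow> bfun X"
      using into by blast
  next
    assume less: "?k < 1"
    show "mcomplete_of (bfun_metric X :: ('a \<Rightarrow> 'y) metric)"
      by (rule mcomplete_of_bfun_metric)
    show "contractive (bfun_metric X) ?T"
      by (rule contr[OF less])
    obtain p where p: "p \<in> bfun X" "\<forall>f\<in>bfun X. ?T f = f \<longleftrightarrow> f = p"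
      using fixpoint[OF less] by blast
    then have p_eq: "\<forall>x\<in>X. p x = ?T p x"
      by metis
    show "\<exists>fstar \<in> bfun X.
        (\<forall>f \<in> bfun X. ?T f = f \<longleftrightarrow> f = fstar) \<and>
        (\<forall>x\<in>X. fstar x =
            (\<Sum>i=1..N. indicator (u i ` Xi i) x *\<^sub>R (lam i \<circ> inv_into (Xi i) (u i)) x)
          + (\<Sum>i=1..N. indicator (u i ` Xi i) x *\<^sub>R
               ((S i \<circ> inv_into (Xi i) (u i)) x *\<^sub>R
                (restrict fstar (Xi i) \<circ> inv_into (Xi i) (u i)) x))) \<and>
        (\<forall>i\<in>{1..N}. \<forall>x\<in>Xi i.
            (fstar \<circ> u i) x = lam i x + S i x *\<^sub>R restrict fstar (Xi i) x)"
      using p p_eq p_eq[unfolded equiv]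
      by (intro bexI[of _ p] conjI) (simp_all only: rhs cong: ball_cong, simp_all)
    show "\<forall>f \<in> bfun X.
        (\<forall>x\<in>X. f x =
            (\<Sum>i=1..N. indicator (u i ` Xi i) x *\<^sub>R (lam i \<circ> inv_into (Xi i) (u i)) x)
          + (\<Sum>i=1..N. indicator (u i ` Xi i) x *\<^sub>R
               ((S i \<circ> inv_into (Xi i) (u i)) x *\<^sub>R
                (restrict f (Xi i) \<circ> inv_into (Xi i) (u i)) x)))
        \<longleftrightarrow>
        (\<forall>i\<in>{1..N}. \<forall>x\<in>Xi i.
            (f \<circ> u i) x = lam i x + S i x *\<^sub>R restrict f (Xi i) x)"
      using equiv by (simp only: rhs cong: ball_cong) blast
  qed
qed

end
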